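(* For every positive integer $n$, the smallest order of a simple connected $(4n-1)$-regular graph having \textbf{rna} number one is at most $12n-2$. Moreover, for $n=1$ this bound is attained: the smallest order of a simple connected cubic graph having \textbf{rna} number one is exactly $10$.
   Context: All graphs are simple, connected and undirected. For a graph $G$ of order $N$, the \textbf{rna} number $\sigma^{-}(G)$ is the minimum, over all bijections $f: V(G)\to\{1,2,\dots,N\}$, of the number of edges $uv$ of $G$ such that $f(u)$ and $f(v)$ have different parity. *)

theory Defs
  imports "Graph_Theory.Digraph_Component"
begin

text \<open>
  Finite simple undirected graphs are the \<^const>\<open>pair_graph\<close>s, where an edge \<open>uv\<close> is represented
  by the two arcs \<open>(u, v)\<close> and \<open>(v, u)\<close>.
\<close>

definition parity_cut :: "'a pair_pre_digraph \<Rightarrow> ('a \<Rightarrow> nat) \<Rightarrow> 'a set set" where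
  "parity_cut G f = {{u, v} |u v. (u, v) \<in> parcs G \<and> odd (f u) \<noteq> odd (f v)}"

definition rna_number :: "'a pair_pre_digraph \<Rightarrow> nat" where
  "rna_number G =
    (LEAST k. \<exists>f. bij_betw f (pverts G) {1..card (pverts G)} \<and> k = card (parity_cut G f))"

definition regular_graph :: "nat \<Rightarrow> 'a pair_pre_digraph \<Rightarrow> bool" where
  "regular_graph d G \<longleftrightarrow> (\<forall>v \<in> pverts G. out_degree (with_proj G) v = d)"

definition regular_rna_one :: "nat \<Rightarrow> 'a pair_pre_digraph \<Rightarrow> bool" where
  "regular_rna_one d G \<longleftrightarrow>
    pair_graph G \<and> connected (with_proj G) \<and> regular_graph d G \<and> rna_number G = 1"

text \<open>
  Vertices are taken in \<^typ>\<open>nat\<close>, as HOL cannot quantify over types inside a formula; the lemma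
  \<open>regular_rna_one_order\<close> below shows that this loses no orders.
\<close>

definition regular_rna_one_orders :: "nat \<Rightarrow> nat set" where
  "regular_rna_one_orders d = {card (pverts G) |G :: nat pair_pre_digraph. regular_rna_one d G}"

text \<open>
  A relation rather than a \<open>LEAST\<close> term, so that the existence of such a graph is part of the claim.
\<close>

definition is_smallest_order :: "nat \<Rightarrow> nat \<Rightarrow> bool" where
  "is_smallest_order d N \<longleftrightarrow>
    N \<in> regular_rna_one_orders d \<and> (\<forall>M \<in> regular_rna_one_orders d. N \<le> M)"

lemma regular_rna_one_order:
  fixes G :: "'a pair_pre_digraph"
  assumes G: "regular_rna_one d G"
  shows "card (pverts G) \<in> regular_rna_one_orders d"
proof -
  interpret pair_graph G using G by (simp add: regular_rna_one_def)
  let ?V = "pverts G"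
  have finV: "finite ?V" by (rule pair_finite_verts)
  obtain h where h: "bij_betw h ?V {0..<card ?V}"
    using ex_bij_betw_finite_nat[OF finV] by blast
  then have inj: "inj_on h ?V" by (simp add: bij_betw_def)
  define H where "H = \<lparr>pverts = h ` ?V, parcs = map_prod h h ` parcs G\<rparr>"
  have sub: "u \<in> ?V" "v \<in> ?V" if "(u, v) \<in> parcs G" for u v
    using that wellformed' by auto
  have pH: "pverts H = h ` ?V" "parcs H = map_prod h h ` parcs G" by (simp_all add: H_def)
  have cardH: "card (pverts H) = card ?V" using inj by (simp add: pH card_image)
  have "pair_graph H"
  proof
    show "finite (pverts H)" "finite (parcs H)"
      using finV pair_finite_arcs by (simp_all add: pH)
    show "fst e \<in> pverts H" "snd e \<in> pverts H" if "e \<in> parcs H" for e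
      using that sub by (auto simp: pH)
    show "fst e \<noteq> snd e" if e: "e \<in> parcs H" for e
    proof -
      obtain u v where uv: "(u, v) \<in> parcs G" "e = (h u, h v)" using e by (auto simp: pH)
      then have "u \<noteq> v" using pair_no_loops by fastforce
      then show ?thesis using uv sub inj by (auto simp: inj_on_def)
    qed
    have "sym (parcs G)" using pair_sym_arcs by (simp add: symmetric_def)
    then have "sym (parcs H)" by (fastforce simp: pH sym_def)
    then show "symmetric (with_proj H)" by (simp add: symmetric_def)
  qed
  moreover have "connected (with_proj H)"
  proof -
    have c: "connected (with_proj G)" using G by (simp add: regular_rna_one_def)
    let ?S = "with_proj (mk_symmetric (with_proj G))" and ?T = "with_proj (mk_symmetric (with_proj H))"
    have V: "verts ?S = ?V" "verts ?T = h ` ?V" by (simp_all add: mk_symmetric_def pH)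
    have step: "(h u, h v) \<in> arcs_ends ?T" if "(u, v) \<in> arcs_ends ?S" for u v
      using that by (force simp: mk_symmetric_def pH)
    have "h u \<rightarrow>\<^sup>*\<^bsub>?T\<^esub> h v" if "u \<rightarrow>\<^sup>*\<^bsub>?S\<^esub> v" for u v
      using that unfolding reachable_def
    proof (induction rule: rtrancl_on.induct)
      case (rtrancl_on_refl a)
      then show ?case using V by simp
    next
      case (rtrancl_on_into_rtrancl_on a b c)
      then show ?case
        using V step by (metis imageI rtrancl_on.rtrancl_on_into_rtrancl_on)
    qed
    then show ?thesis using c V by (auto simp: connected_def strongly_connected_def)
  qed
  moreover have "regular_graph d H"
    unfolding regular_graph_def
  proof
    fix w assume "w \<in> pverts H"
    then obtain v where v: "v \<in> ?V" "w = h v" by (auto simp: pH)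
    have "out_arcs (with_proj H) w = map_prod h h ` out_arcs (with_proj G) v"
    proof -
      have "{e \<in> map_prod h h ` parcs G. fst e = h v} = map_prod h h ` {e \<in> parcs G. h (fst e) = h v}"
        by auto
      also have "{e \<in> parcs G. h (fst e) = h v} = {e \<in> parcs G. fst e = v}"
        using v(1) arc_fst_in_verts inj_on_eq_iff[OF inj] by blast
      finally show ?thesis using v(2) by (simp add: out_arcs_def pH)
    qed
    moreover have "inj_on (map_prod h h) (out_arcs (with_proj G) v)"
      by (rule inj_on_subset[OF map_prod_inj_on[OF inj inj]]) (use sub in \<open>auto simp: out_arcs_def\<close>)
    ultimately show "out_degree (with_proj H) w = d"
      using G v by (auto simp: out_degree_def card_image regular_rna_one_def regular_graph_def)
  qed
  moreover have "rna_number H = 1"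
  proof -
    have cut: "card (parity_cut H f) = card (parity_cut G (f \<circ> h))" for f
    proof -
      have "parity_cut H f = (\<lambda>e. h ` e) ` parity_cut G (f \<circ> h)" (is "?L = ?R")
      proof
        show "?L \<subseteq> ?R"
        proof
          fix e assume "e \<in> ?L"
          then obtain u v where uv: "(u, v) \<in> parcs G" "odd (f (h u)) \<noteq> odd (f (h v))" "e = {h u, h v}"
            by (auto simp: parity_cut_def pH)
          then have "{u, v} \<in> parity_cut G (f \<circ> h)" by (auto simp: parity_cut_def)
          then have "h ` {u, v} \<in> ?R" by (rule imageI)
          then show "e \<in> ?R" using uv by simp
        qed
        show "?R \<subseteq> ?L" by (fastforce simp: parity_cut_def pH)
      qed
      moreover have "parity_cut G (f \<circ> h) \<subseteq> Pow ?V"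
        using sub by (auto simp: parity_cut_def)
      then have "inj_on (\<lambda>e. h ` e) (parity_cut G (f \<circ> h))"
        using inj_on_image_Pow[OF inj] inj_on_subset by blast
      ultimately show ?thesis by (simp add: card_image)
    qed
    have cong: "parity_cut G f = parity_cut G g" if "\<And>v. v \<in> ?V \<Longrightarrow> f v = g v" for f g
    proof -
      have "(u, v) \<in> parcs G \<and> odd (f u) \<noteq> odd (f v) \<longleftrightarrow> (u, v) \<in> parcs G \<and> odd (g u) \<noteq> odd (g v)"
        for u v using that sub by metis
      then show ?thesis unfolding parity_cut_def by presburger
    qed
    have hH: "bij_betw h ?V (pverts H)" using inj by (simp add: bij_betw_def pH)
    have "(\<exists>f. bij_betw f (pverts H) {1..card (pverts H)} \<and> k = card (parity_cut H f)) \<longleftrightarrow>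
          (\<exists>f. bij_betw f ?V {1..card ?V} \<and> k = card (parity_cut G f))" for k
    proof
      assume "\<exists>f. bij_betw f (pverts H) {1..card (pverts H)} \<and> k = card (parity_cut H f)"
      then show "\<exists>f. bij_betw f ?V {1..card ?V} \<and> k = card (parity_cut G f)"
        using bij_betw_trans[OF hH] cut cardH by metis
    next
      assume "\<exists>f. bij_betw f ?V {1..card ?V} \<and> k = card (parity_cut G f)"
      then obtain f where f: "bij_betw f ?V {1..card ?V}" "k = card (parity_cut G f)" by blast
      let ?g = "f \<circ> the_inv_into ?V h"
      have "bij_betw ?g (pverts H) {1..card (pverts H)}"
        using bij_betw_trans[OF bij_betw_the_inv_into[OF hH] f(1)] cardH by simp
      moreover have "parity_cut G (?g \<circ> h) = parity_cut G f"
        by (rule cong) (simp add: the_inv_into_f_f[OF inj])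
      ultimately show "\<exists>f. bij_betw f (pverts H) {1..card (pverts H)} \<and> k = card (parity_cut H f)"
        using f(2) cut by metis
    qed
    then have "rna_number H = rna_number G" by (simp add: rna_number_def)
    then show ?thesis using G by (simp add: regular_rna_one_def)
  qed
  ultimately have "regular_rna_one d H" by (simp add: regular_rna_one_def)
  then have "card (pverts H) \<in> regular_rna_one_orders d"
    unfolding regular_rna_one_orders_def by blast
  then show ?thesis by (simp only: cardH)
qed

end

theory Submission
  imports Defs
begin

text \<open>
  In fact the smallest order is \<open>8 * n + 2\<close>, that is \<open>2 * d + 4\<close> for \<open>d = 4 * n - 1\<close>.

  Lower bound: rna number one yields a bridge. Let \<open>S\<close> be one of its two sides. Counting arcs
  that start in \<open>S\<close> gives that \<open>d * card S\<close> is odd, and a neighbour of the bridge's end in \<open>S\<close> has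
  its whole closed neighbourhood in \<open>S\<close>, so \<open>card S \<ge> d + 1\<close>. As \<open>d\<close> and \<open>card S\<close> are both odd,
  \<open>card S \<ge> d + 2\<close>.

  Upper bound: on \<open>4 * n + 1\<close> vertices take the complement of a path with three vertices plus a
  perfect matching of the other vertices. The midpoint of the path has degree \<open>d - 1\<close> and all other
  vertices have degree \<open>d\<close>; join two copies by an edge between the two midpoints.
\<close>

lemma even_card_symmetric_irreflexive:
  fixes R :: "('a :: linorder) rel"
  assumes "finite R" "sym R" "irrefl R"
  shows "even (card R)"
proof -
  let ?L = "{e \<in> R. fst e < snd e}"
  let ?U = "{e \<in> R. snd e < fst e}"
  have "?U = prod.swap ` ?L"
    using assms(2) by (force simp: sym_def image_iff)
  then have "card ?U = card ?L"
    by (simp only: card_image[OF inj_swap])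
  moreover have "?L \<union> ?U = R"
  proof (rule set_eqI)
    fix e
    show "e \<in> ?L \<union> ?U \<longleftrightarrow> e \<in> R"
      using assms(3)
      by (cases e, cases "fst e" "snd e" rule: linorder_cases) (auto simp: irrefl_def)
  qed
  then have "card (?L \<union> ?U) = card R"
    by (rule arg_cong)
  moreover have "card (?L \<union> ?U) = card ?L + card ?U"
    by (rule card_Un_disjoint) (use assms(1) in auto)
  ultimately have "card R = card ?L + card ?L" by linarith
  then show ?thesis by simp
qed

context pair_graph
begin

lemma connected_iff_rtrancl:
  "connected (with_proj G) \<longleftrightarrow>
    pverts G \<noteq> {} \<and> (\<forall>u \<in> pverts G. \<forall>v \<in> pverts G. (u, v) \<in> (parcs G)\<^sup>*)"
proof -
  have "u \<rightarrow>\<^sup>*\<^bsub>with_proj (mk_symmetric (with_proj G))\<^esub> v \<longleftrightarrow> (u, v) \<in> (parcs G)\<^sup>*"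
    if "u \<in> pverts G" "v \<in> pverts G" for u v
    using that reachable_mk_symmetric_eq[OF pair_sym_arcs] reachable_conv by simp
  then show ?thesis
    by (auto simp: connected_def strongly_connected_def)
qed

lemma out_degree_eq_card_neighbours: "out_degree (with_proj G) v = card (parcs G `` {v})"
proof -
  have "out_arcs (with_proj G) v = Pair v ` (parcs G `` {v})"
    by (auto simp: out_arcs_def)
  then show ?thesis
    by (simp add: out_degree_def card_image inj_on_def)
qed

lemma finite_parity_cut: "finite (parity_cut G f)"
proof (rule finite_subset)
  show "parity_cut G f \<subseteq> Pow (pverts G)"
    using wellformed' by (auto simp: parity_cut_def)
qed (simp add: pair_finite_verts)

lemma parity_cut_nonempty:
  assumes conn: "connected (with_proj G)" and two: "2 \<le> card (pverts G)"
    and f: "bij_betw f (pverts G) {1..card (pverts G)}"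
  shows "parity_cut G f \<noteq> {}"
proof
  assume empty: "parity_cut G f = {}"
  have step: "odd (f u) = odd (f v)" if "(u, v) \<in> parcs G" for u v
    using empty that by (auto simp: parity_cut_def)
  have const: "odd (f u) = odd (f v)" if "(u, v) \<in> (parcs G)\<^sup>*" for u v
    using that by induction (use step in auto)
  have img: "f ` pverts G = {1..card (pverts G)}"
    using f by (simp add: bij_betw_def)
  have "1 \<in> f ` pverts G" "2 \<in> f ` pverts G"
    using two unfolding img by auto
  then obtain u v where "u \<in> pverts G" "f u = 1" "v \<in> pverts G" "f v = 2"
    by (metis imageE)
  then show False
    using conn const[of u v] unfolding connected_iff_rtrancl by simp
qed

lemma rna_number_attained:
  obtains f where "bij_betw f (pverts G) {1..card (pverts G)}"
    and "rna_number G = card (parity_cut G f)"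
proof -
  let ?P = "\<lambda>k. \<exists>f. bij_betw f (pverts G) {1..card (pverts G)} \<and> k = card (parity_cut G f)"
  have "\<exists>f. bij_betw f (pverts G) {1..card (pverts G)}"
    by (rule finite_same_card_bij) (simp_all add: pair_finite_verts)
  then have "\<exists>k. ?P k" by blast
  then have "?P (rna_number G)"
    unfolding rna_number_def by (rule LeastI_ex)
  then show ?thesis using that by blast
qed

lemma rna_number_eq_oneI:
  assumes "connected (with_proj G)" "2 \<le> card (pverts G)"
    and "bij_betw f (pverts G) {1..card (pverts G)}" "card (parity_cut G f) = 1"
  shows "rna_number G = 1"
  unfolding rna_number_def
proof (rule Least_equality)
  show "\<exists>f. bij_betw f (pverts G) {1..card (pverts G)} \<and> 1 = card (parity_cut G f)"
    using assms(3,4) by metis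
next
  fix k assume "\<exists>f. bij_betw f (pverts G) {1..card (pverts G)} \<and> k = card (parity_cut G f)"
  then obtain g where g: "bij_betw g (pverts G) {1..card (pverts G)}" "k = card (parity_cut G g)"
    by blast
  then have "parity_cut G g \<noteq> {}"
    using parity_cut_nonempty assms(1,2) by blast
  then show "1 \<le> k"
    using g(2) finite_parity_cut by (simp add: Suc_le_eq card_gt_0_iff)
qed

end

lemma card_bridge_side:
  fixes G :: "('a :: linorder) pair_pre_digraph"
  assumes "pair_graph G" and reg: "regular_graph d G" and d: "2 \<le> d"
    and S: "S \<subseteq> pverts G" and u: "u \<in> S" and v: "v \<notin> S" and uv: "(u, v) \<in> parcs G"
    and only: "\<And>x y. (x, y) \<in> parcs G \<Longrightarrow> x \<in> S \<Longrightarrow> y \<notin> S \<Longrightarrow> x = u \<and> y = v"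
  shows "d + 2 \<le> card S"
proof -
  interpret pair_graph G by fact
  let ?A = "parcs G"
  have finS: "finite S" using S pair_finite_verts finite_subset by blast
  have fin: "finite (?A `` X)" for X
    using pair_finite_arcs by (rule finite_Image)
  have deg: "card (?A `` {x}) = d" if "x \<in> S" for x
    using reg that S by (auto simp: regular_graph_def out_degree_eq_card_neighbours)
  have symA: "sym ?A" using pair_sym_arcs by (simp add: symmetric_def)
  have loopfree: "(x, x) \<notin> ?A" for x using pair_no_loops by fastforce

  have "d * card S = (\<Sum>x\<in>S. card (?A `` {x}))"
    using deg by simp
  also have "\<dots> = card (SIGMA x:S. ?A `` {x})"
    using finS fin by simp
  also have "(SIGMA x:S. ?A `` {x}) = insert (u, v) (?A \<inter> S \<times> S)"
  proof -
    have "(x, y) \<in> ?A \<and> x \<in> S \<longleftrightarrow> x = u \<and> y = v \<or> (x, y) \<in> ?A \<and> x \<in> S \<and> y \<in> S" for x y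
      using only u uv by blast
    then show ?thesis by auto
  qed
  also have "card \<dots> = Suc (card (?A \<inter> S \<times> S))"
    using v pair_finite_arcs by simp
  finally have "d * card S = Suc (card (?A \<inter> S \<times> S))" .
  moreover have "even (card (?A \<inter> S \<times> S))"
    by (rule even_card_symmetric_irreflexive)
      (use pair_finite_arcs symA loopfree in \<open>auto simp: sym_def irrefl_def\<close>)
  ultimately have "odd (d * card S)" by simp
  then have odd: "odd d" "odd (card S)" by simp_all

  have "\<not> ?A `` {u} \<subseteq> {v}"
    using card_mono[of "{v}" "?A `` {u}"] deg[OF u] d by auto
  then obtain w where w: "(u, w) \<in> ?A" "w \<noteq> v" by auto
  then have wS: "w \<in> S" and wu: "w \<noteq> u" using only u loopfree by blast+
  then have "insert w (?A `` {w}) \<subseteq> S"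
    using only by blast
  then have "card (insert w (?A `` {w})) \<le> card S"
    by (rule card_mono[OF finS])
  then have "Suc d \<le> card S"
    using fin loopfree deg[OF wS] by simp
  moreover have "Suc d \<noteq> card S" using odd by (metis even_Suc)
  ultimately show ?thesis by simp
qed

lemma regular_rna_one_order_ge:
  fixes G :: "('a :: linorder) pair_pre_digraph"
  assumes G: "regular_rna_one d G" and d: "2 \<le> d"
  shows "2 * d + 4 \<le> card (pverts G)"
proof -
  have "pair_graph G" and reg: "regular_graph d G" and "rna_number G = 1"
    using G by (simp_all add: regular_rna_one_def)
  interpret pair_graph G by fact
  obtain f where "card (parity_cut G f) = 1"
    using rna_number_attained \<open>rna_number G = 1\<close> by metis
  then obtain e where e: "parity_cut G f = {e}"
    by (auto simp: card_1_singleton_iff)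
  then have "e \<in> parity_cut G f" by simp
  then obtain a b where ab: "(a, b) \<in> parcs G" "odd (f a) \<noteq> odd (f b)" "e = {a, b}"
    by (auto simp: parity_cut_def)
  have symA: "sym (parcs G)" using pair_sym_arcs by (simp add: symmetric_def)
  then have ba: "(b, a) \<in> parcs G" using ab(1) by (auto dest: symD)
  have only: "{x, y} = {a, b}" if "(x, y) \<in> parcs G" "odd (f x) \<noteq> odd (f y)" for x y
  proof -
    have "{x, y} \<in> parity_cut G f" using that by (auto simp: parity_cut_def)
    then show ?thesis using e ab(3) by simp
  qed
  define S where "S x = {y \<in> pverts G. odd (f y) = odd (f x)}" for x
  have sub: "x \<in> pverts G" "y \<in> pverts G" if "(x, y) \<in> parcs G" for x y
    using that wellformed' by auto
  have side: "d + 2 \<le> card (S u)"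
    if uv: "(u, v) \<in> parcs G" "odd (f u) \<noteq> odd (f v)" "{u, v} = {a, b}" for u v
  proof (rule card_bridge_side[OF \<open>pair_graph G\<close> reg d])
    show "x = u \<and> y = v" if "(x, y) \<in> parcs G" "x \<in> S u" "y \<notin> S u" for x y
    proof -
      have xy: "odd (f x) = odd (f u)" "odd (f y) \<noteq> odd (f u)"
        using that sub by (auto simp: S_def)
      then have "{x, y} = {u, v}"
        using only[OF that(1)] uv(3) by simp
      then show ?thesis using xy by (auto simp: doubleton_eq_iff)
    qed
  qed (use uv sub in \<open>auto simp: S_def\<close>)
  have "d + 2 \<le> card (S a)" "d + 2 \<le> card (S b)"
    using side[of a b] side[of b a] ab ba by auto
  moreover have "card (S a \<union> S b) = card (S a) + card (S b)"
    by (rule card_Un_disjoint) (use ab(2) pair_finite_verts in \<open>auto simp: S_def\<close>)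
  moreover have "card (S a \<union> S b) \<le> card (pverts G)"
    by (rule card_mono) (auto simp: S_def pair_finite_verts)
  ultimately show ?thesis by simp
qed

text \<open>
  The closed neighbourhoods of the complement of one half: the path is \<open>1 - 0 - 2\<close> and the matching
  consists of the pairs \<open>{3, 4}, {5, 6}, \<dots>\<close>.
\<close>

definition non_neighbours :: "nat \<Rightarrow> nat set" where
  "non_neighbours i =
    (if i = 0 then {0, 1, 2} else if i \<le> 2 then {0, i} else if odd i then {i, i + 1} else {i - 1, i})"

definition bridged_graph :: "nat \<Rightarrow> (nat \<times> bool) pair_pre_digraph" where
  "bridged_graph n = \<lparr>pverts = {..4 * n} \<times> UNIV,
     parcs = {((i, s), (j, t)) |i s j t. i \<le> 4 * n \<and> j \<le> 4 * n \<and>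
       (if s = t then j \<notin> non_neighbours i else i = 0 \<and> j = 0)}\<rparr>"

lemma arc_bridged_graph_iff:
  "((i, s), (j, t)) \<in> parcs (bridged_graph n) \<longleftrightarrow> i \<le> 4 * n \<and> j \<le> 4 * n \<and>
     (if s = t then j \<notin> non_neighbours i else i = 0 \<and> j = 0)"
  by (simp add: bridged_graph_def)

lemma pverts_bridged_graph: "pverts (bridged_graph n) = {..4 * n} \<times> UNIV"
  by (simp add: bridged_graph_def)

lemma non_neighbours_refl: "i \<in> non_neighbours i"
  by (simp add: non_neighbours_def)

lemma non_neighbours_sym: "j \<in> non_neighbours i \<Longrightarrow> i \<in> non_neighbours j"
  by (auto simp: non_neighbours_def split: if_splits)

lemma pair_graph_bridged_graph: "pair_graph (bridged_graph n)"
proof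
  let ?G = "bridged_graph n"
  show wf: "fst e \<in> pverts ?G" "snd e \<in> pverts ?G" if "e \<in> parcs ?G" for e
    using that by (auto simp: bridged_graph_def)
  show fin: "finite (pverts ?G)"
    by (simp add: pverts_bridged_graph)
  show "finite (parcs ?G)"
    by (rule finite_subset[of _ "pverts ?G \<times> pverts ?G"]) (use wf fin in \<open>auto simp: mem_Times_iff\<close>)
  show "fst e \<noteq> snd e" if "e \<in> parcs ?G" for e
    using that non_neighbours_refl by (auto simp: bridged_graph_def)
  have "sym (parcs ?G)"
    by (rule symI) (auto simp: arc_bridged_graph_iff dest: non_neighbours_sym split: if_splits)
  then show "symmetric (with_proj ?G)"
    by (simp add: symmetric_def)
qed

lemma regular_bridged_graph:
  assumes n: "1 \<le> n"
  shows "regular_graph (4 * n - 1) (bridged_graph n)"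
proof -
  interpret pair_graph "bridged_graph n" by (rule pair_graph_bridged_graph)
  have "card (parcs (bridged_graph n) `` {(i, s)}) = 4 * n - 1" if i: "i \<le> 4 * n" for i s
  proof -
    have sub: "non_neighbours i \<subseteq> {..4 * n}"
      using i n by (auto simp: non_neighbours_def elim!: oddE split: if_splits) presburger
    have card: "card (non_neighbours i) = (if i = 0 then 3 else 2)"
      by (auto simp: non_neighbours_def)
    have diff: "card ({..4 * n} - non_neighbours i) = 4 * n + 1 - card (non_neighbours i)"
      using sub by (subst card_Diff_subset) (auto intro: finite_subset)
    have "parcs (bridged_graph n) `` {(i, s)} =
        ({..4 * n} - non_neighbours i) \<times> {s} \<union> (if i = 0 then {(0, \<not> s)} else {})"
      using i by (auto simp: arc_bridged_graph_iff split: if_splits)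
    moreover have "card \<dots> = card (({..4 * n} - non_neighbours i) \<times> {s}) + (if i = 0 then 1 else 0)"
      by (subst card_Un_disjoint) auto
    ultimately show ?thesis
      using n by (simp add: card diff)
  qed
  then show ?thesis
    by (auto simp: regular_graph_def out_degree_eq_card_neighbours pverts_bridged_graph)
qed

lemma connected_bridged_graph:
  assumes n: "1 \<le> n"
  shows "connected (with_proj (bridged_graph n))"
proof -
  interpret pair_graph "bridged_graph n" by (rule pair_graph_bridged_graph)
  let ?R = "(parcs (bridged_graph n))\<^sup>*"
  have "sym (parcs (bridged_graph n))"
    using pair_sym_arcs by (simp add: symmetric_def)
  then have symR: "sym ?R" by (rule sym_rtrancl)
  have bridge: "((0, s), (0, t)) \<in> ?R" for s t
    by (cases "s = t") (auto simp: arc_bridged_graph_iff intro!: r_into_rtrancl)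
  have half: "((i, s), (0, s)) \<in> ?R" if i: "i \<le> 4 * n" for i s
  proof -
    have three: "((3, s), (0, s)) \<in> parcs (bridged_graph n)"
      using n by (simp add: arc_bridged_graph_iff non_neighbours_def)
    consider "i = 0" | "i = 1 \<or> i = 2" | "3 \<le> i" by linarith
    then show ?thesis
    proof cases
      case 2
      then have "((i, s), (3, s)) \<in> parcs (bridged_graph n)"
        using n by (auto simp: arc_bridged_graph_iff non_neighbours_def)
      then show ?thesis using three by (meson converse_rtrancl_into_rtrancl r_into_rtrancl)
    next
      case 3
      then have "((i, s), (0, s)) \<in> parcs (bridged_graph n)"
        using i by (auto simp: arc_bridged_graph_iff non_neighbours_def)
      then show ?thesis by (rule r_into_rtrancl)
    qed simp
  qed
  have "((i, s), (j, t)) \<in> ?R" if "i \<le> 4 * n" "j \<le> 4 * n" for i s j t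
    using half[OF that(1), of s] bridge[of s t] symD[OF symR half[OF that(2), of t]]
    by (meson rtrancl_trans)
  then show ?thesis
    by (auto simp: connected_iff_rtrancl pverts_bridged_graph)
qed

lemma card_pverts_bridged_graph: "card (pverts (bridged_graph n)) = 8 * n + 2"
  by (simp add: pverts_bridged_graph card_cartesian_product)

lemma rna_number_bridged_graph:
  assumes n: "1 \<le> n"
  shows "rna_number (bridged_graph n) = 1"
proof -
  interpret pair_graph "bridged_graph n" by (rule pair_graph_bridged_graph)
  define f :: "nat \<times> bool \<Rightarrow> nat" where "f = (\<lambda>(i, s). 2 * i + 1 + of_bool s)"
  have "bij_betw f (pverts (bridged_graph n)) {1..card (pverts (bridged_graph n))}"
    unfolding card_pverts_bridged_graph pverts_bridged_graph
    by (rule bij_betw_byWitness[where f' = "\<lambda>k. ((k - 1) div 2, even k)"])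
      (auto simp: f_def of_bool_def elim!: evenE oddE)
  moreover have "parity_cut (bridged_graph n) f = {{(0, False), (0, True)}}"
    by (auto 0 3 simp: parity_cut_def arc_bridged_graph_iff f_def doubleton_eq_iff split: if_splits)
  ultimately show ?thesis
    using rna_number_eq_oneI[OF connected_bridged_graph[OF n]] card_pverts_bridged_graph
    by simp
qed

lemma smallest_order_regular_rna_one:
  assumes n: "1 \<le> n"
  shows "is_smallest_order (4 * n - 1) (8 * n + 2)"
proof -
  have "regular_rna_one (4 * n - 1) (bridged_graph n)"
    unfolding regular_rna_one_def
    using n pair_graph_bridged_graph connected_bridged_graph regular_bridged_graph
      rna_number_bridged_graph by blast
  then have "8 * n + 2 \<in> regular_rna_one_orders (4 * n - 1)"
    using regular_rna_one_order card_pverts_bridged_graph by metis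
  moreover have "8 * n + 2 \<le> M" if "M \<in> regular_rna_one_orders (4 * n - 1)" for M
    using that regular_rna_one_order_ge[of "4 * n - 1"] n
    by (fastforce simp: regular_rna_one_orders_def)
  ultimately show ?thesis by (simp add: is_smallest_order_def)
qed

theorem theorem6p8:
  shows "(\<forall>n :: nat. 1 \<le> n \<longrightarrow> (\<exists>N. is_smallest_order (4 * n - 1) N \<and> N \<le> 12 * n - 2)) \<and>
         is_smallest_order 3 10"
proof (intro conjI allI impI)
  fix n :: nat assume "1 \<le> n"
  then show "\<exists>N. is_smallest_order (4 * n - 1) N \<and> N \<le> 12 * n - 2"
    by (intro exI[of _ "8 * n + 2"] conjI smallest_order_regular_rna_one) simp_all
next
  show "is_smallest_order 3 10"
    using smallest_order_regular_rna_one[of 1] by simp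
qed

end
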